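(* Let $f:\mathbb{D}\to\mathbb{P}$ be meromorphic with $\mathbb{A}_S(f(\mathbb{D}))<\infty$. For any $\theta\in\mathbb{R}$ and $\rho_0>0$, let $L_S(\rho_0)=\int_0^{\rho_0}\|f'(\gamma(t))\|_{H\to S}\,dt$, where $\gamma(t)=\tanh(\frac{t}{2})e^{i\theta}$; this is the spherical length of the image under $f$ of the radial segment of hyperbolic length $\rho_0$ from $0$ in direction $\theta$. Then $$L_S(\rho_0)=o(\rho_0^{1/2})\quad\text{as }\rho_0\to\infty.$$
   Context: $\mathbb{D}=\{|z|<1\}$ carries the hyperbolic metric with density $\lambda_H(z)=2/(1-|z|^2)$. $\mathbb{P}=\mathbb{C}\cup\{\infty\}$ carries the spherical metric with density $\lambda_S(w)=2/(1+|w|^2)$. $\|f'(z)\|_{H\to S}=\frac{2|f'(z)|}{1+|f(z)|^2}\cdot\frac{1-|z|^2}{2}$ (extended continuously at poles). $\mathbb{A}_S(f(\mathbb{D}))=\int_{\mathbb{D}}|f'(z)|^2\lambda_S(f(z))^2\,dx\,dy$ is the spherical area of the image counting multiplicity. *)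

theory Defs
  imports "HOL-Analysis.Analysis" "HOL-Library.Landau_Symbols"
begin

abbreviation unit_disc :: "complex set" where
  "unit_disc \<equiv> ball 0 1"

text \<open>A meromorphic function f on the unit disc with values in the Riemann sphere,
  represented by a complex-valued function together with its pole set P:
  P is a subset of the disc without accumulation points in the disc,
  f is holomorphic off P, and f tends to infinity at each point of P
  (the value of f at a pole, i.e. infinity, is not represented).\<close>
definition meromorphic_disc :: "(complex \<Rightarrow> complex) \<Rightarrow> complex set \<Rightarrow> bool" where
  "meromorphic_disc f P \<longleftrightarrow>
     P \<subseteq> unit_disc \<and>
     (\<forall>z\<in>unit_disc. \<not> z islimpt P) \<and>
     f holomorphic_on (unit_disc - P) \<and>
     (\<forall>p\<in>P. filterlim f at_infinity (at p))"

definition sph_dens :: "(complex \<Rightarrow> complex) \<Rightarrow> complex \<Rightarrow> real" where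
  "sph_dens f z = 2 * norm (deriv f z) / (1 + (norm (f z))\<^sup>2)"

definition hs_norm :: "(complex \<Rightarrow> complex) \<Rightarrow> complex set \<Rightarrow> complex \<Rightarrow> real" where
  "hs_norm f P z =
     (if z \<in> P then Lim (at z) (\<lambda>w. sph_dens f w * (1 - (norm w)\<^sup>2) / 2)
      else sph_dens f z * (1 - (norm z)\<^sup>2) / 2)"

text \<open>Spherical area of the image counting multiplicity:
  integral over the disc of |f'|^2 * lambda_S(f)^2.\<close>
definition sph_area :: "(complex \<Rightarrow> complex) \<Rightarrow> ennreal" where
  "sph_area f = (\<integral>\<^sup>+ z. ennreal ((norm (deriv f z))\<^sup>2 * (2 / (1 + (norm (f z))\<^sup>2))\<^sup>2)
                   * indicator unit_disc z \<partial>lborel)"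

definition radial_sph_length ::
  "(complex \<Rightarrow> complex) \<Rightarrow> complex set \<Rightarrow> real \<Rightarrow> real \<Rightarrow> real" where
  "radial_sph_length f P \<theta> r =
     integral {0..r} (\<lambda>t. hs_norm f P (complex_of_real (tanh (t / 2)) * cis \<theta>))"

end

theory Submission
  imports Defs "HOL-Complex_Analysis.Cauchy_Integral_Formula"
begin

text \<open>
  The spherical derivative \<open>v\<close> of \<open>f\<close> extends continuously over the poles, where it is computed
  from \<open>1/f\<close>.  If \<open>v \<le> 2 v(z\<^sub>0)\<close> on a disc around \<open>z\<^sub>0\<close> whose radius is at most a small
  multiple of \<open>1 / v(z\<^sub>0)\<close>, then \<open>f\<close> or \<open>1/f\<close> stays bounded there, and the Cauchy estimates for the
  second derivative keep \<open>v\<close> comparable to \<open>v(z\<^sub>0)\<close> on a smaller concentric disc.  Maximising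
  \<open>(\<rho> - |z - a|) v(z)\<close> produces such a \<open>z\<^sub>0\<close> and yields an \<open>\<epsilon>\<close>-regularity estimate: if the
  spherical area of the disc of radius \<open>\<rho>\<close> around \<open>a\<close> is small, it dominates \<open>(\<rho> v(a))\<^sup>2\<close>.

  On the ray, the squared integrand at time \<open>t\<close> is therefore eventually at most
  \<open>K (H(t + 2) - H(t - 2))\<close>, where \<open>H(t)\<close> is the area of the hyperbolic disc of radius \<open>t\<close> around
  \<open>0\<close>.  As \<open>H\<close> is monotone and bounded, the integral of this bound telescopes to a small tail, and
  AM-GM with weight of order \<open>1 / \<surd>r\<close> gives \<open>o(\<surd>r)\<close>.
\<close>

subsection \<open>Local control of the spherical derivative\<close>

lemma sph_dens_le_iff:
  "sph_dens g z \<le> M \<longleftrightarrow> 2 * norm (deriv g z) \<le> M * (1 + (norm (g z))\<^sup>2)"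
  by (simp add: sph_dens_def pos_divide_le_eq add_pos_nonneg)

lemma sph_dens_nonneg: "sph_dens g z \<ge> 0"
  by (simp add: sph_dens_def)

text \<open>A barrier argument: where \<open>norm (g z) < 2\<close>, the bound on
  \<open>sph_dens\<close> gives |g'| <= 5M/2, so g moves by at most 5Mr/2 <= 1/2 from a value of
  modulus at most 1 and cannot approach 2. By \<open>inf\<close>, points of the disc outside
  \<open>U\<close> behave like poles, so the same bound excludes them.\<close>

lemma bounded_near_center:
  fixes g :: "complex \<Rightarrow> complex"
  assumes U: "open U" and g: "g holomorphic_on U"
    and z0: "z0 \<in> U" "norm (g z0) \<le> 1"
    and inf: "\<And>y. y \<in> ball z0 r - U \<Longrightarrow> filterlim g at_infinity (at y within U)"
    and M: "\<And>z. z \<in> ball z0 r \<inter> U \<Longrightarrow> sph_dens g z \<le> M" "M * r \<le> 1/5" "0 \<le> M"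
    and z: "z \<in> ball z0 r"
  shows "z \<in> U" "norm (g z) < 2"
proof -
  define V where "V = {z\<in>U. norm (g z) < 2}"
  have cg: "continuous_on U g"
    using g holomorphic_on_imp_continuous_on by blast
  have V: "open V"
    using continuous_open_preimage[OF cg U open_ball[of 0 2]]
    by (simp add: V_def Collect_conj_eq vimage_def)
  have "z \<in> V"
  proof (rule ccontr)
    assume "z \<notin> V"
    have "closed (- V)" "- V \<noteq> {}"
      using V \<open>z \<notin> V\<close> by auto
    \<comment> \<open>The point outside \<open>V\<close> nearest to \<open>z0\<close>: the open disc
      reaching up to it lies in \<open>V\<close> and is convex, so the mean value bound applies
      there.\<close>
    then obtain y where y: "y \<in> - V" "\<And>w. w \<in> - V \<Longrightarrow> dist z0 y \<le> dist z0 w"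
      using distance_attains_inf by blast
    have yr: "dist z0 y < r"
      using y(2)[of z] \<open>z \<notin> V\<close> z by auto
    define d where "d = dist z0 y"
    have z0V: "z0 \<in> V"
      using z0 by (auto simp: V_def)
    then have d0: "d > 0"
      using y(1) unfolding d_def by auto
    have BV: "ball z0 d \<subseteq> V"
      using y(2) by (force simp: d_def)
    have bd: "norm (g w) \<le> 3/2" if w: "w \<in> ball z0 d" for w
    proof -
      have "norm (g w - g z0) \<le> (5/2 * M) * norm (w - z0)"
      proof (rule field_differentiable_bound)
        fix x assume x: "x \<in> ball z0 d"
        then have xU: "x \<in> U" "norm (g x) < 2"
          using BV by (auto simp: V_def)
        show "(g has_field_derivative deriv g x) (at x within ball z0 d)"
          using holomorphic_derivI[OF g U xU(1)] has_field_derivative_at_within by blast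
        have "sph_dens g x \<le> M"
          using x xU yr by (intro M) (auto simp: d_def)
        then have "2 * norm (deriv g x) \<le> M * (1 + (norm (g x))\<^sup>2)"
          by (simp add: sph_dens_le_iff)
        also have "\<dots> \<le> M * (1 + 2\<^sup>2)"
          using xU M(3) by (intro mult_left_mono add_left_mono power_mono) auto
        finally show "norm (deriv g x) \<le> 5/2 * M" by simp
      qed (use w d0 in auto)
      also have "\<dots> \<le> (5/2 * M) * r"
        using w yr M(3) by (intro mult_left_mono) (auto simp: d_def dist_norm norm_minus_commute)
      also have "\<dots> \<le> 1/2"
        using M(2) by simp
      finally show ?thesis
        using z0(2) norm_triangle_ineq2[of "g w" "g z0"] by linarith
    qed
    \<comment> \<open>The bound 3/2 extends to the boundary point \<open>y\<close>: by continuity it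
      contradicts \<open>y\<close> not in \<open>V\<close> if \<open>y\<close> is in
      \<open>U\<close>; otherwise it contradicts divergence to infinity.\<close>
    have ycl: "y islimpt ball z0 d"
      using d0 by (auto simp: islimpt_ball d_def)
    then have nt: "at y within ball z0 d \<noteq> bot"
      by (simp add: trivial_limit_within)
    have BU: "ball z0 d \<subseteq> U"
      using BV by (auto simp: V_def)
    show False
    proof (cases "y \<in> U")
      case True
      then have "(g \<longlongrightarrow> g y) (at y within ball z0 d)"
        using cg BU by (meson continuous_on_def tendsto_within_subset)
      then have "norm (g y) \<le> 3/2"
        using nt bd by (intro tendsto_upperbound[OF tendsto_norm])
          (auto simp: eventually_at_filter)
      then show False
        using y(1) True by (auto simp: V_def)
    next
      case False
      then have "filterlim g at_infinity (at y within ball z0 d)"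
        using inf[of y] yr BU by (meson DiffI at_le filterlim_mono mem_ball order_refl)
      then have "\<forall>\<^sub>F w in at y within ball z0 d. 2 \<le> norm (g w)"
        by (auto simp: filterlim_at_infinity[of 0])
      moreover have "\<forall>\<^sub>F w in at y within ball z0 d. norm (g w) \<le> 3/2"
        using bd by (auto simp: eventually_at_filter)
      ultimately have "\<forall>\<^sub>F w in at y within ball z0 d. False"
        by eventually_elim auto
      then show False
        using nt by (simp add: eventually_False)
    qed
  qed
  then show "z \<in> U" "norm (g z) < 2"
    by (auto simp: V_def)
qed

text \<open>Let v be the spherical derivative at \<open>z0\<close>. Since |g| < 2, |g'| is at most
  5v, and the Cauchy estimate on discs of radius r/2 bounds g'' by 10v/r. Within radius r/40, g'
  therefore changes by at most v/4.\<close>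

lemma sph_dens_ge_near_center:
  fixes g :: "complex \<Rightarrow> complex"
  assumes U: "open U" and g: "g holomorphic_on U"
    and z0: "z0 \<in> U" "norm (g z0) \<le> 1"
    and inf: "\<And>y. y \<in> ball z0 r - U \<Longrightarrow> filterlim g at_infinity (at y within U)"
    and M: "\<And>z. z \<in> ball z0 r \<inter> U \<Longrightarrow> sph_dens g z \<le> 2 * sph_dens g z0"
      "2 * sph_dens g z0 * r \<le> 1/5"
    and z: "z \<in> ball z0 (r/40)"
  shows "z \<in> U" "sph_dens g z \<ge> sph_dens g z0 / 10"
proof -
  define v where "v = sph_dens g z0"
  have v0: "v \<ge> 0"
    by (simp add: v_def sph_dens_def)
  have r: "r > 0"
    using le_less_trans[OF zero_le_dist z[unfolded mem_ball]] by simp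
  have b: "x \<in> U \<and> norm (g x) < 2" if "x \<in> ball z0 r" for x
    using bounded_near_center[OF U g z0 inf M] that v0 unfolding v_def
    by (meson mult_nonneg_nonneg zero_le_numeral)
  show zU: "z \<in> U"
    using b z r by auto
  have g': "deriv g holomorphic_on U"
    using g U holomorphic_deriv by blast
  have g1: "norm (deriv g x) \<le> 5 * v" if x: "x \<in> ball z0 r" for x
  proof -
    have "sph_dens g x \<le> 2 * v"
      using M(1)[of x] x b[OF x] by (simp add: v_def)
    then have "2 * norm (deriv g x) \<le> 2 * v * (1 + (norm (g x))\<^sup>2)"
      by (simp add: sph_dens_le_iff)
    also have "\<dots> \<le> 2 * v * (1 + 2\<^sup>2)"
      using b[OF x] v0 by (intro mult_left_mono add_left_mono power_mono) auto
    finally show ?thesis by simp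
  qed
  have g2: "norm (deriv (deriv g) x) \<le> 10 * v / r" if x: "x \<in> ball z0 (r/2)" for x
  proof -
    have sub: "cball x (r/2) \<subseteq> ball z0 r"
    proof
      fix w assume "w \<in> cball x (r/2)"
      then show "w \<in> ball z0 r"
        using x dist_triangle[of z0 w x] by auto
    qed
    then have hol: "deriv g holomorphic_on cball x (r/2)"
      using g' b by (meson holomorphic_on_subset subset_eq)
    have "norm ((deriv ^^ 1) (deriv g) x) \<le> fact 1 * (5 * v) / (r/2) ^ 1"
    proof (rule Cauchy_inequality)
      show "deriv g holomorphic_on ball x (r/2)"
        using hol ball_subset_cball holomorphic_on_subset by blast
      show "continuous_on (cball x (r/2)) (deriv g)"
        using hol holomorphic_on_imp_continuous_on by blast
      fix w assume "norm (x - w) = r/2"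
      then have "w \<in> cball x (r/2)"
        by (simp add: dist_norm)
      then show "norm (deriv g w) \<le> 5 * v"
        using sub g1 by blast
    qed (use r in auto)
    then show ?thesis by simp
  qed
  have "norm (deriv g z - deriv g z0) \<le> (10 * v / r) * norm (z - z0)"
  proof (rule field_differentiable_bound)
    fix x assume x: "x \<in> ball z0 (r/2)"
    then have "x \<in> U"
      using b r by auto
    then show "(deriv g has_field_derivative deriv (deriv g) x) (at x within ball z0 (r/2))"
      using holomorphic_derivI[OF g' U] has_field_derivative_at_within by blast
    show "norm (deriv (deriv g) x) \<le> 10 * v / r"
      using g2 x .
  qed (use z r in auto)
  also have "\<dots> \<le> (10 * v / r) * (r/40)"
    using z v0 r by (intro mult_left_mono) (auto simp: dist_norm norm_minus_commute)
  also have "\<dots> = v / 4"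
    using r by simp
  finally have 1: "norm (deriv g z - deriv g z0) \<le> v/4" .
  \<comment> \<open>|g'(z0)| >= v/2 leaves |g'(z)| >= v/4; the denominator is at most 5, whence the
    factor 1/10.\<close>
  have "v \<le> 2 * norm (deriv g z0)"
    by (simp add: v_def sph_dens_le_iff distrib_left)
  then have "norm (deriv g z) \<ge> v/4"
    using 1 norm_triangle_ineq2[of "deriv g z0" "deriv g z"] by (simp add: norm_minus_commute)
  moreover have "(norm (g z))\<^sup>2 \<le> 2\<^sup>2"
    using b[of z] z r by (intro power_mono) auto
  ultimately have "2 * (v/4) / (1 + 2\<^sup>2) \<le> sph_dens g z"
    unfolding sph_dens_def using v0 by (intro frac_le) (auto simp: add_pos_nonneg)
  then show "sph_dens g z \<ge> sph_dens g z0 / 10"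
    by (simp add: v_def)
qed

subsection \<open>The spherical derivative across poles\<close>

text \<open>The chart at infinity. The value 0 fills the removable singularity at a pole. At a zero
  of \<open>f\<close> off \<open>P\<close> the convention \<open>inverse 0 = 0\<close> gives a
  spurious value, so holomorphy is claimed only on \<open>nonzero\<close>.\<close>

definition recip :: "(complex \<Rightarrow> complex) \<Rightarrow> complex set \<Rightarrow> complex \<Rightarrow> complex" where
  "recip f P z = (if z \<in> P then 0 else inverse (f z))"

text \<open>The spherical metric is invariant under w -> 1/w, so at a pole the density of 1/f is the
  continuous extension.\<close>

definition sph_deriv :: "(complex \<Rightarrow> complex) \<Rightarrow> complex set \<Rightarrow> complex \<Rightarrow> real" where
  "sph_deriv f P z = (if z \<in> P then sph_dens (recip f P) z else sph_dens f z)"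

lemma sph_deriv_nonneg: "sph_deriv f P z \<ge> 0"
  by (simp add: sph_deriv_def sph_dens_nonneg)

lemma isCont_sph_dens:
  assumes "open U" "g holomorphic_on U" "z \<in> U"
  shows "isCont (sph_dens g) z"
proof -
  have "isCont g z" "isCont (deriv g) z"
    using assms holomorphic_deriv[OF assms(2,1)] holomorphic_on_imp_continuous_on
      continuous_on_eq_continuous_at by blast+
  then have "isCont (\<lambda>z. 2 * norm (deriv g z) / (1 + (norm (g z))\<^sup>2)) z"
    by (intro continuous_intros) (auto simp: add_nonneg_eq_0_iff)
  then show ?thesis
    by (simp add: sph_dens_def[abs_def])
qed

locale meromorphic_disc_map =
  fixes f :: "complex \<Rightarrow> complex" and P :: "complex set"
  assumes meromorphic: "meromorphic_disc f P"
begin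

text \<open>The preimages of the two standard charts of the sphere; together they cover the
  disc.\<close>

abbreviation "reg \<equiv> unit_disc - P"
abbreviation "nonzero \<equiv> {z \<in> unit_disc. z \<in> P \<or> f z \<noteq> 0}"

lemma poles_subset: "P \<subseteq> unit_disc"
  and holo: "f holomorphic_on reg"
  and pole: "p \<in> P \<Longrightarrow> filterlim f at_infinity (at p)"
  using meromorphic by (auto simp: meromorphic_disc_def)

lemma poles_sparse: "P sparse_in unit_disc"
  using meromorphic by (auto simp: meromorphic_disc_def sparse_in_open)

lemma eventually_not_pole: "z \<in> unit_disc \<Longrightarrow> \<forall>\<^sub>F w in at z. w \<notin> P"
  using poles_sparse sparse_in_eventually_iff[OF open_ball] by blast

lemma countable_poles: "countable P"
  using sparse_imp_countable[OF open_ball poles_sparse] poles_subset by (simp add: Int_absorb1)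

lemma open_reg: "open reg"
proof -
  have "\<forall>\<^sub>F w in nhds z. w \<in> reg" if "z \<in> reg" for z
  proof -
    have "\<forall>\<^sub>F w in nhds z. w \<notin> P" "\<forall>\<^sub>F w in nhds z. w \<in> unit_disc"
      using that eventually_not_pole[of z] eventually_nhds_in_open[OF open_ball, of z 0 1]
      by (auto simp: eventually_nhds_conv_at)
    then show ?thesis
      by eventually_elim auto
  qed
  then show ?thesis
    by (subst open_subopen) (auto simp: eventually_nhds subset_eq)
qed

lemma eventually_reg_near_pole:
  assumes "p \<in> P"
  shows "\<forall>\<^sub>F w in at p. w \<in> reg \<and> f w \<noteq> 0"
proof -
  have p: "p \<in> unit_disc"
    using assms poles_subset by auto
  have "\<forall>\<^sub>F w in at p. w \<in> unit_disc"
    using eventually_at_in_open'[OF open_ball p] .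
  moreover have "\<forall>\<^sub>F w in at p. f w \<noteq> 0"
    using pole[OF assms] filterlim_at_infinity_imp_eventually_ne by blast
  ultimately show ?thesis
    using eventually_not_pole[OF p] by eventually_elim auto
qed

lemma open_nonzero: "open nonzero"
proof -
  have cont: "continuous_on reg f"
    using holo holomorphic_on_imp_continuous_on by blast
  have "\<forall>\<^sub>F w in nhds z. w \<in> nonzero" if z: "z \<in> nonzero" for z
  proof (cases "z \<in> P")
    case True
    then have "\<forall>\<^sub>F w in at z. w \<in> nonzero"
      using eventually_reg_near_pole[OF True] by (auto elim: eventually_mono)
    then show ?thesis
      using z by (auto simp: eventually_at_filter elim: eventually_mono)
  next
    case False
    have "open (reg \<inter> f -` (- {0}))"
      using continuous_open_preimage[OF cont open_reg, of "-{0}"] by (simp add: open_Compl)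
    then have "\<forall>\<^sub>F w in nhds z. w \<in> reg \<inter> f -` (- {0})"
      using False z by (intro eventually_nhds_in_open) auto
    then show ?thesis
      by eventually_elim auto
  qed
  then show ?thesis
    by (subst open_subopen) (auto simp: eventually_nhds subset_eq)
qed

lemma eventually_recip: "z \<in> reg \<Longrightarrow> \<forall>\<^sub>F w in nhds z. recip f P w = inverse (f w)"
  by (rule eventually_mono[OF eventually_nhds_in_open[OF open_reg]]) (auto simp: recip_def)

text \<open>At a pole 1/f tends to 0, the value of \<open>recip\<close> there, so the singularity is
  removable.\<close>

lemma holo_recip: "recip f P holomorphic_on nonzero"
proof -
  have "recip f P field_differentiable at z" if z: "z \<in> nonzero" for z
  proof (cases "z \<in> P")
    case False
    then have zr: "z \<in> reg" "f z \<noteq> 0"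
      using z by auto
    have "(\<lambda>w. inverse (f w)) field_differentiable at z"
      using holo zr open_reg holomorphic_on_imp_differentiable_at
      by (intro derivative_intros) blast+
    moreover have "\<forall>\<^sub>F w in nhds z. inverse (f w) = recip f P w"
      using eventually_recip[OF zr(1)] by eventually_elim simp
    ultimately show ?thesis
      unfolding field_differentiable_def using DERIV_cong_ev by metis
  next
    case True
    obtain e where e: "e > 0" "\<And>w. w \<noteq> z \<Longrightarrow> dist w z < e \<Longrightarrow> w \<in> reg \<and> f w \<noteq> 0"
      using eventually_reg_near_pole[OF True] by (auto simp: eventually_at)
    have "(\<lambda>w. inverse (f w)) holomorphic_on ball z e - {z}"
      using e(2) holo by (intro holomorphic_intros) (auto simp: dist_commute intro: holomorphic_on_subset)
    then have hol: "recip f P holomorphic_on ball z e - {z}"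
      by (rule holomorphic_transform) (use e(2) in \<open>auto simp: recip_def dist_commute\<close>)
    have "(recip f P \<longlongrightarrow> recip f P z) (at z)"
    proof -
      have "((\<lambda>w. inverse (f w)) \<longlongrightarrow> 0) (at z)"
        using filterlim_compose[OF tendsto_inverse_0 pole[OF True]] .
      moreover have "\<forall>\<^sub>F w in at z. inverse (f w) = recip f P w"
        by (rule eventually_mono[OF eventually_not_pole]) (use z in \<open>auto simp: recip_def\<close>)
      ultimately show ?thesis
        using True by (simp add: recip_def Lim_transform_eventually)
    qed
    then have "(recip f P \<longlongrightarrow> recip f P z) (at z within ball z e)"
      using tendsto_within_subset by blast
    then have "recip f P holomorphic_on ball z e"
      using no_isolated_singularity'[of "{z}" "recip f P" "ball z e"] hol by simp
    then show ?thesis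
      using e(1) holomorphic_on_imp_differentiable_at[OF _ open_ball] by auto
  qed
  then show ?thesis
    using field_differentiable_at_within holomorphic_on_def by blast
qed

lemma sph_deriv_reg: "z \<in> reg \<Longrightarrow> sph_deriv f P z = sph_dens f z"
  by (simp add: sph_deriv_def)

text \<open>Inversion is a spherical isometry: |(1/f)'| = |f'|/|f|^2, and the factor cancels against
  the denominator.\<close>

lemma sph_deriv_nonzero:
  assumes "z \<in> nonzero"
  shows "sph_deriv f P z = sph_dens (recip f P) z"
proof (cases "z \<in> P")
  case False
  with assms have z: "z \<in> reg" "f z \<noteq> 0"
    by auto
  have "deriv (recip f P) z = deriv (\<lambda>w. inverse (f w)) z"
    using eventually_recip[OF z(1)] by (rule deriv_cong_ev) simp
  also have "\<dots> = - deriv f z / (f z)\<^sup>2"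
    using holomorphic_derivI[OF holo open_reg z(1)] z(2)
    by (intro DERIV_imp_deriv) (auto intro!: derivative_eq_intros simp: power2_eq_square field_simps)
  finally have "sph_dens (recip f P) z = 2 * (norm (deriv f z) / (norm (f z))\<^sup>2) / (1 + inverse ((norm (f z))\<^sup>2))"
    using z by (simp add: sph_dens_def recip_def norm_divide norm_inverse norm_power power_inverse)
  also have "\<dots> = sph_dens f z"
  proof -
    have "(norm (f z))\<^sup>2 > 0" using z by simp
    then show ?thesis
      unfolding sph_dens_def by (simp add: divide_simps add_pos_pos add_pos_nonneg)
  qed
  finally show ?thesis
    using False by (simp add: sph_deriv_def)
qed (simp add: sph_deriv_def)

lemma isCont_sph_deriv:
  assumes "z \<in> unit_disc"
  shows "isCont (sph_deriv f P) z"
proof (cases "z \<in> P")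
  case True
  then have z: "z \<in> nonzero" using assms by auto
  have "\<forall>\<^sub>F w in nhds z. sph_deriv f P w = sph_dens (recip f P) w"
    using eventually_nhds_in_open[OF open_nonzero z] by eventually_elim (rule sph_deriv_nonzero)
  then show ?thesis
    using isCont_sph_dens[OF open_nonzero holo_recip z] by (simp add: isCont_cong)
next
  case False
  then have z: "z \<in> reg" using assms by auto
  have "\<forall>\<^sub>F w in nhds z. sph_deriv f P w = sph_dens f w"
    using eventually_nhds_in_open[OF open_reg z] by eventually_elim (rule sph_deriv_reg)
  then show ?thesis
    using isCont_sph_dens[OF open_reg holo z] by (simp add: isCont_cong)
qed

text \<open>Poles are isolated, so near a pole the density of \<open>f\<close> agrees with the
  continuous \<open>sph_deriv\<close>; this evaluates the \<open>Lim\<close> in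
  \<open>hs_norm\<close>.\<close>

lemma hs_norm_eq:
  assumes "z \<in> unit_disc"
  shows "hs_norm f P z = sph_deriv f P z * (1 - (norm z)\<^sup>2) / 2"
proof (cases "z \<in> P")
  case True
  have "((\<lambda>w. sph_deriv f P w * (1 - (norm w)\<^sup>2) / 2) \<longlongrightarrow> sph_deriv f P z * (1 - (norm z)\<^sup>2) / 2) (at z)"
    using isCont_sph_deriv[OF assms] by (intro tendsto_intros) (auto simp: isCont_def)
  moreover have "\<forall>\<^sub>F w in at z. sph_deriv f P w * (1 - (norm w)\<^sup>2) / 2 = sph_dens f w * (1 - (norm w)\<^sup>2) / 2"
    using eventually_not_pole[OF assms] by eventually_elim (simp add: sph_deriv_def)
  ultimately have "((\<lambda>w. sph_dens f w * (1 - (norm w)\<^sup>2) / 2) \<longlongrightarrow> sph_deriv f P z * (1 - (norm z)\<^sup>2) / 2) (at z)"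
    by (rule Lim_transform_eventually)
  then show ?thesis
    using True by (simp add: hs_norm_def tendsto_Lim)
qed (simp add: hs_norm_def sph_deriv_def)

text \<open>One of f(z0), 1/f(z0) has modulus at most 1; working in that chart reduces the claim to
  the holomorphic estimate.\<close>

lemma sph_deriv_ge_near_center:
  assumes ball: "ball z0 r \<subseteq> unit_disc"
    and M: "\<And>z. z \<in> ball z0 r \<Longrightarrow> sph_deriv f P z \<le> 2 * sph_deriv f P z0"
      "2 * sph_deriv f P z0 * r \<le> 1/5"
    and z: "z \<in> ball z0 (r/40)"
  shows "sph_deriv f P z \<ge> sph_deriv f P z0 / 10"
proof -
  have "r > 0"
    using le_less_trans[OF zero_le_dist z[unfolded mem_ball]] by simp
  then have z0: "z0 \<in> unit_disc"
    using ball by (meson centre_in_ball subsetD)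
  show ?thesis
  proof (cases "z0 \<in> P \<or> norm (f z0) > 1")
    case False
    then have z0: "z0 \<in> reg" "norm (f z0) \<le> 1"
      using z0 by auto
    have M': "sph_dens f w \<le> 2 * sph_dens f z0" if "w \<in> ball z0 r \<inter> reg" for w
      using M(1)[of w] that sph_deriv_reg z0(1) by simp
    have inf: "filterlim f at_infinity (at y within reg)" if "y \<in> ball z0 r - reg" for y
    proof -
      have "filterlim f at_infinity (at y)"
        using that ball by (intro pole) auto
      then show ?thesis
        by (meson at_le filterlim_mono order_refl subset_UNIV)
    qed
    have M2: "2 * sph_dens f z0 * r \<le> 1/5"
      using M(2) sph_deriv_reg[OF z0(1)] by simp
    note * = sph_dens_ge_near_center[OF open_reg holo z0 inf M' M2 z]
    show ?thesis
      using * sph_deriv_reg z0(1) by presburger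
  next
    case True
    then have z0: "z0 \<in> nonzero" "norm (recip f P z0) \<le> 1"
      using z0 by (auto simp: recip_def norm_inverse inverse_le_1_iff)
    have M': "sph_dens (recip f P) w \<le> 2 * sph_dens (recip f P) z0" if "w \<in> ball z0 r \<inter> nonzero" for w
      using M(1)[of w] that sph_deriv_nonzero z0(1) by simp
    \<comment> \<open>The points of the disc missing from \<open>nonzero\<close> are the zeros of
      \<open>f\<close>. Approach within \<open>nonzero\<close> keeps f away from the value 0, so 1/f
      tends to infinity.\<close>
    have inf: "filterlim (recip f P) at_infinity (at y within nonzero)" if "y \<in> ball z0 r - nonzero" for y
    proof -
      have y: "y \<in> reg" "f y = 0"
        using ball that by auto
      have "(f \<longlongrightarrow> f y) (at y within nonzero)"
        using holo y(1) open_reg by (meson continuous_on_eq_continuous_at continuous_within holomorphic_on_imp_continuous_on tendsto_within_subset top_greatest)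
      moreover have ev: "\<forall>\<^sub>F w in at y within nonzero. w \<in> reg"
        using eventually_nhds_in_open[OF open_reg y(1)] by (auto simp: eventually_at_filter elim: eventually_mono)
      then have "\<forall>\<^sub>F w in at y within nonzero. f w \<noteq> 0"
        by (auto simp: eventually_at_filter elim!: eventually_mono)
      ultimately have "filterlim f (at 0) (at y within nonzero)"
        using y(2) by (simp add: filterlim_at)
      then have "filterlim (\<lambda>w. inverse (f w)) at_infinity (at y within nonzero)"
        by (rule filterlim_compose[OF filterlim_inverse_at_infinity])
      moreover have "\<forall>\<^sub>F w in at y within nonzero. inverse (f w) = recip f P w"
        using ev by eventually_elim (auto simp: recip_def)
      note filterlim_cong[OF refl refl this]
      ultimately show ?thesis
        by blast
    qed
    have M2: "2 * sph_dens (recip f P) z0 * r \<le> 1/5"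
      using M(2) sph_deriv_nonzero[OF z0(1)] by simp
    note * = sph_dens_ge_near_center[OF open_nonzero holo_recip z0 inf M' M2 z]
    show ?thesis
      using * sph_deriv_nonzero z0(1) by presburger
  qed
qed

end

subsection \<open>Area and \<open>\<epsilon>\<close>-regularity\<close>

locale finite_area_map = meromorphic_disc_map +
  assumes finite_area: "sph_area f < \<infinity>"
begin

text \<open>As a measure, area is monotone and additive in the set at no cost. Using
  \<open>sph_deriv\<close> makes the density continuous on the disc, hence measurable.\<close>

definition area_measure :: "complex measure" where
  "area_measure = density lborel (\<lambda>z. ennreal (indicator unit_disc z *\<^sub>R (sph_deriv f P z)\<^sup>2))"

abbreviation "area \<equiv> measure area_measure"

lemma sph_deriv_measurable:
  "(\<lambda>z. indicator unit_disc z *\<^sub>R (sph_deriv f P z)\<^sup>2) \<in> borel_measurable borel"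
  using isCont_sph_deriv
  by (intro borel_measurable_continuous_on_indicator continuous_intros)
     (auto intro: continuous_at_imp_continuous_on)

lemma sets_area_measure [simp]: "sets area_measure = sets borel"
  by (simp add: area_measure_def)

lemma space_area_measure [simp]: "space area_measure = UNIV"
  by (simp add: area_measure_def)

lemma emeasure_area_measure:
  "A \<in> sets borel \<Longrightarrow> emeasure area_measure A =
     (\<integral>\<^sup>+z. ennreal (indicator unit_disc z *\<^sub>R (sph_deriv f P z)\<^sup>2) * indicator A z \<partial>lborel)"
  unfolding area_measure_def using sph_deriv_measurable by (subst emeasure_density) auto

text \<open>The two densities differ at most on the poles, a countable and so null set.\<close>

lemma emeasure_area_measure_UNIV: "emeasure area_measure UNIV = sph_area f"
proof -
  have "AE z in lborel. z \<notin> P"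
    using countable_imp_null_set_lborel[OF countable_poles] by (rule AE_not_in)
  then have "(\<integral>\<^sup>+z. ennreal (indicator unit_disc z *\<^sub>R (sph_deriv f P z)\<^sup>2) \<partial>lborel) = sph_area f"
    unfolding sph_area_def
    by (intro nn_integral_cong_AE, eventually_elim)
       (auto simp: sph_deriv_def sph_dens_def indicator_def power_mult_distrib power_divide)
  then show ?thesis
    by (simp add: emeasure_area_measure)
qed

sublocale area: finite_measure area_measure
  using finite_area by (intro finite_measureI) (simp add: emeasure_area_measure_UNIV)

lemma area_ball_ge:
  assumes "ball z s \<subseteq> unit_disc" "s \<ge> 0" "m \<ge> 0"
    and m: "\<And>w. w \<in> ball z s \<Longrightarrow> sph_deriv f P w \<ge> m"
  shows "area (ball z s) \<ge> m\<^sup>2 * s\<^sup>2 * measure lborel (ball (0::complex) 1)"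
proof -
  have "ennreal (m\<^sup>2 * s\<^sup>2 * measure lborel (ball (0::complex) 1)) = ennreal (m\<^sup>2) * ennreal (measure lborel (ball z s))"
    using assms by (simp add: content_ball_conv_unit_ball[of s z] ennreal_mult' mult.assoc)
  also have "\<dots> = ennreal (m\<^sup>2) * emeasure lborel (ball z s)"
    using emeasure_lborel_ball_finite[of z s] by (subst emeasure_eq_ennreal_measure) auto
  also have "\<dots> = (\<integral>\<^sup>+w. ennreal (m\<^sup>2) * indicator (ball z s) w \<partial>lborel)"
    by (simp add: nn_integral_cmult_indicator)
  also have "\<dots> \<le> emeasure area_measure (ball z s)"
    using assms m by (subst emeasure_area_measure)
      (auto intro!: nn_integral_mono ennreal_leI power_mono simp: indicator_def subset_eq)
  finally show ?thesis
    by (simp add: area.emeasure_eq_measure)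
qed

text \<open>The lower bound v(z0)/10 on the disc of radius r/40 produces 160000 = 400^2.\<close>

lemma area_ball_ge_sph_deriv:
  assumes "ball z0 r \<subseteq> unit_disc" "r > 0"
    and "\<And>z. z \<in> ball z0 r \<Longrightarrow> sph_deriv f P z \<le> 2 * sph_deriv f P z0"
      "2 * sph_deriv f P z0 * r \<le> 1/5"
  shows "area (ball z0 r) \<ge> measure lborel (ball (0::complex) 1) / 160000 * (r * sph_deriv f P z0)\<^sup>2"
proof -
  have sub: "ball z0 (r/40) \<subseteq> ball z0 r"
    using assms(2) by (intro subset_ball) auto
  have "(sph_deriv f P z0 / 10)\<^sup>2 * (r/40)\<^sup>2 * measure lborel (ball (0::complex) 1) \<le> area (ball z0 (r/40))"
    using sub assms sph_deriv_ge_near_center[OF assms(1,3,4)]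
    by (intro area_ball_ge) (auto simp: sph_deriv_nonneg)
  also have "\<dots> \<le> area (ball z0 r)"
    using sub by (intro area.finite_measure_mono) auto
  finally show ?thesis
    by (simp add: power_divide power_mult_distrib mult_ac)
qed

text \<open>Point selection replaces \<open>a\<close> by a point \<open>z0\<close> around which v is
  at most doubled, at the price of a factor: \<rho> v(a) <= 2 s v(z0). The smallness of the area is
  what allows the lower area bound to be used at the full scale \<open>s\<close>.\<close>

lemma epsilon_regularity:
  obtains \<epsilon> K where "\<epsilon> > 0" "K > 0"
    "\<And>a \<rho>. \<rho> > 0 \<Longrightarrow> cball a \<rho> \<subseteq> unit_disc \<Longrightarrow> area (ball a \<rho>) < \<epsilon> \<Longrightarrow>
       (\<rho> * sph_deriv f P a)\<^sup>2 \<le> K * area (ball a \<rho>)"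
proof -
  define c where "c = measure lborel (ball (0::complex) 1) / 160000"
  have c: "c > 0"
    unfolding c_def by (simp add: content_ball_pos)
  have "(\<rho> * sph_deriv f P a)\<^sup>2 \<le> 4/c * area (ball a \<rho>)"
    if \<rho>: "\<rho> > 0" "cball a \<rho> \<subseteq> unit_disc" "area (ball a \<rho>) < c/100" for a \<rho>
  proof (cases "sph_deriv f P a = 0")
    case True
    then show ?thesis
      using c by simp
  next
    case False
    define v where "v = sph_deriv f P"
    have v: "v z \<ge> 0" for z
      by (simp add: v_def sph_deriv_nonneg)
    have va: "v a > 0"
      using v[of a] False by (simp add: v_def)
    have "continuous_on (cball a \<rho>) v"
      using \<rho>(2) isCont_sph_deriv unfolding v_def by (intro continuous_at_imp_continuous_on) auto
    then have "continuous_on (cball a \<rho>) (\<lambda>z. (\<rho> - dist a z) * v z)"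
      by (intro continuous_intros)
    then obtain z0 where z0: "z0 \<in> cball a \<rho>"
      and max: "\<And>z. z \<in> cball a \<rho> \<Longrightarrow> (\<rho> - dist a z) * v z \<le> (\<rho> - dist a z0) * v z0"
      using continuous_attains_sup[OF compact_cball, of a \<rho> "\<lambda>z. (\<rho> - dist a z) * v z"] \<rho>(1) by force
    \<comment> \<open>Half the weight at \<open>z0\<close>: on the disc of radius \<open>s\<close>
      the weight stays at least \<open>s\<close>, so maximality gives v <= 2 v(z0) there.\<close>
    define s where "s = (\<rho> - dist a z0) / 2"
    have s2: "2 * s = \<rho> - dist a z0"
      by (simp add: s_def)
    have a_le: "\<rho> * v a \<le> 2 * s * v z0"
      unfolding s2 using max[of a] \<rho>(1) by simp
    moreover have "\<rho> * v a > 0"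
      using \<rho>(1) va by simp
    ultimately have "0 < s * v z0"
      by linarith
    then have s: "s > 0" and v0: "v z0 > 0"
      using v[of z0] by (auto simp: zero_less_mult_iff)
    \<comment> \<open>The cap 1/(10 v(z0)) is exactly what 2 v(z0) r <= 1/5 requires.\<close>
    define r where "r = min s (1 / (10 * v z0))"
    have r: "r > 0" "r \<le> s"
      using s v0 by (auto simp: r_def)
    have near: "s \<le> \<rho> - dist a z" if "z \<in> ball z0 s" for z
      using that dist_triangle[of a z z0] by (simp add: s_def field_simps)
    have sub: "ball z0 r \<subseteq> ball a \<rho>"
    proof
      fix z assume "z \<in> ball z0 r"
      then have "s \<le> \<rho> - dist a z"
        using r by (intro near) auto
      then show "z \<in> ball a \<rho>"
        using s by simp
    qed
    have "v z \<le> 2 * v z0" if "z \<in> ball z0 r" for z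
    proof -
      have "z \<in> ball z0 s"
        using that r by auto
      then have "s * v z \<le> (\<rho> - dist a z) * v z"
        using near v by (intro mult_right_mono) auto
      also have "\<dots> \<le> 2 * s * v z0"
        unfolding s2 using sub that by (intro max) (meson ball_subset_cball subsetD)
      finally show ?thesis
        using s by (simp add: mult.assoc mult.left_commute)
    qed
    moreover have "2 * v z0 * r \<le> 2 * v z0 * (1 / (10 * v z0))"
      unfolding r_def using v0 by (intro mult_left_mono) auto
    then have "2 * v z0 * r \<le> 1/5"
      using v0 by simp
    moreover have "ball z0 r \<subseteq> unit_disc"
      using sub \<rho>(2) ball_subset_cball by blast
    ultimately have "c * (r * v z0)\<^sup>2 \<le> area (ball z0 r)"
      using area_ball_ge_sph_deriv[of z0 r] r(1) by (simp add: c_def v_def)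
    also have "\<dots> \<le> area (ball a \<rho>)"
      using sub by (intro area.finite_measure_mono) auto
    finally have le: "c * (r * v z0)\<^sup>2 \<le> area (ball a \<rho>)" .
    \<comment> \<open>If the cap were active, r v(z0) = 1/10 would force area at least c/100, the
      excluded threshold.\<close>
    have "r = s"
    proof (rule ccontr)
      assume "r \<noteq> s"
      then have "r * v z0 = 1/10"
        using v0 by (auto simp: r_def min_def split: if_splits)
      then show False
        using le \<rho>(3) unfolding \<open>r * v z0 = 1/10\<close> by (simp add: power2_eq_square)
    qed
    have "(\<rho> * v a)\<^sup>2 \<le> (2 * s * v z0)\<^sup>2"
      using a_le \<rho>(1) va by (intro power_mono) auto
    also have "\<dots> = 4/c * (c * (r * v z0)\<^sup>2)"
      using c \<open>r = s\<close> by (simp add: power_mult_distrib)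
    also have "\<dots> \<le> 4/c * area (ball a \<rho>)"
      using le c by (intro mult_left_mono) auto
    finally show ?thesis
      by (simp add: v_def)
  qed
  then show thesis
    using c by (intro that[of "c/100" "4/c"]) auto
qed

end

subsection \<open>Growth of the length along a ray\<close>

text \<open>After shifting, the integrals over the common interval from T + s to r - s cancel. Two
  windows of length 2s remain, on which H is at most H(T - s) + \<delta> and at least H(T - s)
  respectively.\<close>

lemma integral_shift_diff_le:
  fixes H :: "real \<Rightarrow> real"
  assumes H: "mono H" and T: "T + 2 * s \<le> r" "s \<ge> 0"
    and \<delta>: "\<And>t. H t \<le> H (T - s) + \<delta>"
  shows "(\<lambda>t. H (t + s) - H (t - s)) integrable_on {T..r}"
    and "integral {T..r} (\<lambda>t. H (t + s) - H (t - s)) \<le> 2 * s * \<delta>"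
proof -
  have int: "H integrable_on {a..b}" for a b
    by (rule integrable_on_mono_on) (rule mono_on_subset[OF H subset_UNIV])
  have shift: "((\<lambda>t. H (t + c)) has_integral integral {T+c..r+c} H) {T..r}" for c
  proof -
    have "(H \<circ> (+) c has_integral integral {T+c..r+c} H) {T..r}"
      unfolding has_integral_shift_Icc_real using int by (rule integrable_integral)
    then show ?thesis
      by (simp add: o_def add.commute)
  qed
  have diff: "((\<lambda>t. H (t + s) - H (t - s)) has_integral
      (integral {T+s..r+s} H - integral {T-s..r-s} H)) {T..r}"
    using has_integral_diff[OF shift[of s] shift[of "-s"]] by simp
  then show "(\<lambda>t. H (t + s) - H (t - s)) integrable_on {T..r}"
    by blast
  have "integral {T+s..r+s} H = integral {T+s..r-s} H + integral {r-s..r+s} H"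
    using T int by (intro Henstock_Kurzweil_Integration.integral_combine[symmetric]) auto
  moreover have "integral {T-s..r-s} H = integral {T-s..T+s} H + integral {T+s..r-s} H"
    using T int by (intro Henstock_Kurzweil_Integration.integral_combine[symmetric]) auto
  moreover have "integral {r-s..r+s} H \<le> integral {r-s..r+s} (\<lambda>_. H (T-s) + \<delta>)"
    using int \<delta> by (intro integral_le) auto
  moreover have "integral {T-s..T+s} (\<lambda>_. H (T-s)) \<le> integral {T-s..T+s} H"
    using int monoD[OF H] by (intro integral_le) auto
  ultimately have "integral {T+s..r+s} H - integral {T-s..r-s} H \<le> 2 * s * \<delta>"
    using T by (simp add: algebra_simps)
  then show "integral {T..r} (\<lambda>t. H (t + s) - H (t - s)) \<le> 2 * s * \<delta>"
    using diff by (simp add: integral_unique)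
qed

text \<open>The square bound alone would give only O(sqrt r); the little-o comes from splitting off
  a fixed initial segment, after which the remaining growth of \<open>H\<close> is as small as
  desired.\<close>

lemma integral_smallo_sqrt:
  fixes h H :: "real \<Rightarrow> real"
  assumes H: "mono H" "bdd_above (range H)" and K: "K > 0"
    and int: "\<And>r. h integrable_on {0..r}" and h0: "\<And>t. t \<ge> 0 \<Longrightarrow> h t \<ge> 0"
    and h: "\<forall>\<^sub>F t in at_top. (h t)\<^sup>2 \<le> K * (H (t + 2) - H (t - 2))"
  shows "(\<lambda>r. integral {0..r} h) \<in> o[at_top](sqrt)"
proof (rule landau_o.smallI)
  fix c :: real assume "c > 0"
  \<comment> \<open>Half of c absorbs the initial segment, half the tail. With the weight
    \<open>\<mu>\<close> = \<eta> / sqrt r below, this \<delta> balances AM-GM: each of the two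
    terms is at most \<eta> sqrt r / 2.\<close>
  define \<eta> where "\<eta> = c / 2"
  define \<delta> where "\<delta> = \<eta>\<^sup>2 / (4 * K)"
  have \<eta>: "\<eta> > 0" and \<delta>: "\<delta> > 0"
    using \<open>c > 0\<close> K by (simp_all add: \<eta>_def \<delta>_def)
  obtain T1 where T1: "H T1 > (SUP t. H t) - \<delta>"
    using less_cSUP_iff[of UNIV H "(SUP t. H t) - \<delta>"] H(2) \<delta> by auto
  obtain T2 where T2: "\<And>t. t \<ge> T2 \<Longrightarrow> (h t)\<^sup>2 \<le> K * (H (t + 2) - H (t - 2))"
    using h by (auto simp: eventually_at_top_linorder)
  define T where "T = max 0 (max (T1 + 2) T2)"
  have T: "T \<ge> 0" "T1 \<le> T - 2" "T2 \<le> T"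
    by (auto simp: T_def)
  have \<delta>': "H t \<le> H (T - 2) + \<delta>" for t
    using cSUP_upper[of t UNIV H] H(2) T1 monoD[OF H(1) T(2)] by simp
  define I where "I = integral {0..T} h"
  have "filterlim (\<lambda>r. \<eta> * sqrt r) at_top at_top"
    using \<eta> by (intro filterlim_tendsto_pos_mult_at_top[OF tendsto_const] sqrt_at_top)
  then have "\<forall>\<^sub>F r in at_top. I \<le> \<eta> * sqrt r"
    by (simp add: filterlim_at_top)
  moreover have "\<forall>\<^sub>F r in at_top. T + 4 \<le> r"
    by (rule eventually_ge_at_top)
  ultimately show "\<forall>\<^sub>F r in at_top. norm (integral {0..r} h) \<le> c * norm (sqrt r)"
  proof eventually_elim
    case (elim r)
    define \<mu> where "\<mu> = \<eta> / sqrt r"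
    have r: "r > 0" "T \<le> r"
      using elim T by auto
    have \<mu>: "\<mu> > 0"
      using \<eta> r by (simp add: \<mu>_def)
    let ?D = "\<lambda>t. H (t + 2) - H (t - 2)"
    have D: "?D integrable_on {T..r}" "integral {T..r} ?D \<le> 4 * \<delta>"
      using integral_shift_diff_le[OF H(1) _ _ \<delta>', of r] elim by auto
    have hint: "h integrable_on {T..r}"
      by (rule integrable_subinterval_real[OF int[of r]]) (use T in auto)
    have "integral {T..r} h \<le> integral {T..r} (\<lambda>t. \<mu> / 2 + K / (2 * \<mu>) * ?D t)"
    proof (rule integral_le[OF hint])
      show "(\<lambda>t. \<mu> / 2 + K / (2 * \<mu>) * ?D t) integrable_on {T..r}"
        using D(1) by (intro integrable_add integrable_on_mult_right) auto
      fix t assume "t \<in> {T..r}"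
      then have "(h t)\<^sup>2 \<le> K * ?D t"
        using T2 T by simp
      moreover have "0 \<le> (\<mu> - h t)\<^sup>2"
        by simp
      ultimately have "2 * \<mu> * h t \<le> \<mu>\<^sup>2 + K * ?D t"
        by (simp add: power2_diff algebra_simps)
      then have "h t \<le> (\<mu>\<^sup>2 + K * ?D t) / (2 * \<mu>)"
        using \<mu> by (simp add: pos_le_divide_eq mult.commute)
      also have "\<dots> = \<mu> / 2 + K / (2 * \<mu>) * ?D t"
        using \<mu> by (simp add: add_divide_distrib power2_eq_square)
      finally show "h t \<le> \<mu> / 2 + K / (2 * \<mu>) * ?D t" .
    qed
    also have "\<dots> = \<mu> / 2 * (r - T) + K / (2 * \<mu>) * integral {T..r} ?D"
    proof -
      have "((\<lambda>t. \<mu> / 2 + K / (2 * \<mu>) * ?D t) has_integral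
          ((r - T) * (\<mu> / 2) + K / (2 * \<mu>) * integral {T..r} ?D)) {T..r}"
        using has_integral_const_real[of "\<mu> / 2" T r] r D(1)
        by (intro has_integral_add has_integral_mult_right) (auto simp: integrable_integral)
      then show ?thesis
        by (simp add: integral_unique mult.commute)
    qed
    also have "\<dots> \<le> \<mu> / 2 * r + K / (2 * \<mu>) * (4 * \<delta>)"
      using D(2) \<mu> K T by (intro add_mono mult_left_mono) auto
    also have "\<dots> = \<eta> * sqrt r"
      using \<eta> K r by (simp add: \<mu>_def \<delta>_def field_simps power2_eq_square)
    finally have "integral {T..r} h \<le> \<eta> * sqrt r" .
    moreover have "integral {0..r} h = I + integral {T..r} h"
      unfolding I_def using T r int
      by (intro Henstock_Kurzweil_Integration.integral_combine[symmetric]) auto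
    moreover have "integral {0..r} h \<ge> 0"
      using int h0 by (intro integral_nonneg) auto
    ultimately show ?case
      using elim(1) r by (simp add: \<eta>_def)
  qed
qed

section \<open>Hyperbolic radius against Euclidean distance to the unit circle\<close>

lemma tanh_half_eq: "tanh (t / 2) = 1 - 2 * exp (- t) / (1 + exp (- t))" for t :: real
proof -
  have "1 + exp (- t) > 0"
    by (simp add: add_pos_pos)
  then show ?thesis
    by (simp add: tanh_real_altdef field_simps)
qed

text \<open>Moving radially by half the Euclidean distance to the unit circle changes the hyperbolic
  radius by at most 2; this is the source of the shifts by 2.\<close>

lemma tanh_half_bounds:
  fixes t :: real
  assumes "t \<ge> 0"
  shows "tanh (t/2) + (1 - tanh (t/2)) / 2 \<le> tanh ((t + 2) / 2)"
    and "tanh ((t - 2) / 2) \<le> tanh (t/2) - (1 - tanh (t/2)) / 2"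
proof -
  define y where "y = exp (- t)"
  define Q where "Q = exp (2::real)"
  have y: "0 < y" "y \<le> 1"
    using assms by (auto simp: y_def)
  have Q: "Q \<ge> 3"
    using exp_ge_add_one_self[of "2::real"] by (simp add: Q_def)
  \<comment> \<open>That half distance. The claims become \<open>1 - tanh\<close> <= w at t + 2 and
    >= 3w at t - 2, and both follow from y <= 1 and Q >= 3.\<close>
  define w where "w = y / (1 + y)"
  have x: "tanh (t/2) = 1 - 2 * w"
    by (simp add: tanh_half_eq y_def w_def)
  have "exp (- (t + 2)) = y / Q" "exp (- (t - 2)) = y * Q"
    by (simp_all add: y_def Q_def exp_diff exp_minus exp_add field_simps)
  then have p: "tanh ((t + 2) / 2) = 1 - 2 * (y / Q) / (1 + y / Q)"
    and m: "tanh ((t - 2) / 2) = 1 - 2 * (y * Q) / (1 + y * Q)"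
    using tanh_half_eq[of "t + 2"] tanh_half_eq[of "t - 2"] by simp_all
  have le_upper: "1 - 2 * w + (1 - (1 - 2 * w)) / 2 \<le> 1 - A" if "A \<le> w" for A
    using that by simp
  have le_lower: "1 - A \<le> 1 - 2 * w - (1 - (1 - 2 * w)) / 2" if "3 * w \<le> A" for A
    using that by simp
  have "2 * (y / Q) / (1 + y / Q) = 2 * y / (Q + y)"
    using Q y by (simp add: field_simps)
  also have "\<dots> \<le> w"
  proof -
    have "2 * (1 + y) \<le> Q + y"
      using Q y(2) by simp
    then have "y * (2 * (1 + y)) \<le> y * (Q + y)"
      using y by (intro mult_left_mono) auto
    then show ?thesis
      using y Q by (simp add: w_def divide_simps mult_ac)
  qed
  finally show "tanh (t/2) + (1 - tanh (t/2)) / 2 \<le> tanh ((t + 2) / 2)"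
    unfolding x p by (rule le_upper)
  have "3 * w \<le> 2 * (y * Q) / (1 + y * Q)"
  proof -
    have "y * Q \<le> Q"
      using y Q by (simp add: mult_le_cancel_right1)
    then have "y * Q + 3 \<le> 2 * Q"
      using Q by linarith
    then have "3 * (1 + y * Q) \<le> 2 * Q * (1 + y)"
      by (simp add: algebra_simps)
    then have "y * (3 * (1 + y * Q)) \<le> y * (2 * Q * (1 + y))"
      using y by (intro mult_left_mono) auto
    then show ?thesis
      using y Q by (simp add: w_def divide_simps mult_ac add_pos_pos)
  qed
  then show "tanh ((t - 2) / 2) \<le> tanh (t/2) - (1 - tanh (t/2)) / 2"
    unfolding x m by (rule le_lower)
qed

section \<open>Area of hyperbolic annuli and the estimate along the ray\<close>

context finite_area_map
begin

text \<open>For negative t the radius is negative and the ball empty, so monotonicity holds on all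
  reals, as the shifts t - 2 require.\<close>

definition disc_area :: "real \<Rightarrow> real" where
  "disc_area t = area (ball 0 (tanh (t / 2)))"

lemma mono_disc_area: "mono disc_area"
  unfolding disc_area_def
  by (intro monoI area.finite_measure_mono subset_ball) auto

lemma bdd_above_disc_area: "bdd_above (range disc_area)"
  unfolding disc_area_def by (intro bdd_aboveI2[of _ _ "area UNIV"] area.finite_measure_mono) auto

text \<open>The triangle inequality places the disc in the annulus between hyperbolic radii t - 2
  and t + 2.\<close>

lemma area_ball_le:
  assumes "t \<ge> 0" "norm u = 1"
  defines "x \<equiv> tanh (t / 2)"
  shows "area (ball (complex_of_real x * u) ((1 - x) / 2)) \<le> disc_area (t + 2) - disc_area (t - 2)"
proof -
  have x: "0 \<le> x"
    using assms by simp
  then have nx: "norm (complex_of_real x * u) = x"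
    using assms by (simp add: norm_mult)
  have "ball (complex_of_real x * u) ((1 - x) / 2) \<subseteq> ball 0 (tanh ((t + 2) / 2)) - ball 0 (tanh ((t - 2) / 2))"
  proof
    fix z assume "z \<in> ball (complex_of_real x * u) ((1 - x) / 2)"
    then have "norm (z - complex_of_real x * u) < (1 - x) / 2"
      by (simp add: dist_norm norm_minus_commute)
    then have "norm z < x + (1 - x) / 2" "norm z > x - (1 - x) / 2"
      using norm_triangle_ineq2[of z "complex_of_real x * u"]
        norm_triangle_ineq2[of "complex_of_real x * u" z] nx
      unfolding norm_minus_commute[of "complex_of_real x * u" z] by linarith+
    then show "z \<in> ball 0 (tanh ((t + 2) / 2)) - ball 0 (tanh ((t - 2) / 2))"
      using tanh_half_bounds[OF assms(1)] by (simp add: x_def)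
  qed
  then have "area (ball (complex_of_real x * u) ((1 - x) / 2)) \<le>
      area (ball 0 (tanh ((t + 2) / 2)) - ball 0 (tanh ((t - 2) / 2)))"
    by (intro area.finite_measure_mono) auto
  also have "\<dots> = disc_area (t + 2) - disc_area (t - 2)"
    unfolding disc_area_def
    by (intro area.finite_measure_Diff subset_ball) auto
  finally show ?thesis .
qed

lemma hs_norm_ray_smallo:
  assumes u: "norm u = 1"
  shows "(\<lambda>r. integral {0..r} (\<lambda>t. hs_norm f P (complex_of_real (tanh (t / 2)) * u))) \<in> o[at_top](sqrt)"
proof -
  obtain \<epsilon> K where \<epsilon>: "\<epsilon> > 0" and K: "K > 0" and reg:
    "\<And>a \<rho>. \<rho> > 0 \<Longrightarrow> cball a \<rho> \<subseteq> unit_disc \<Longrightarrow> area (ball a \<rho>) < \<epsilon> \<Longrightarrow>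
       (\<rho> * sph_deriv f P a)\<^sup>2 \<le> K * area (ball a \<rho>)"
    using epsilon_regularity by blast
  define \<gamma> where "\<gamma> t = complex_of_real (tanh (t / 2)) * u" for t
  have norm_\<gamma>: "norm (\<gamma> t) = \<bar>tanh (t / 2)\<bar>" for t
    by (simp add: \<gamma>_def norm_mult u)
  have \<gamma>: "\<gamma> t \<in> unit_disc" for t
    using tanh_real_lt_1[of "t / 2"] tanh_real_gt_neg1[of "t / 2"] by (simp add: norm_\<gamma> abs_less_iff)
  have hs: "hs_norm f P (\<gamma> t) = sph_deriv f P (\<gamma> t) * (1 - (norm (\<gamma> t))\<^sup>2) / 2" for t
    using \<gamma> by (rule hs_norm_eq)
  have hs0: "hs_norm f P (\<gamma> t) \<ge> 0" for t
    using \<gamma>[of t] by (simp add: hs sph_deriv_nonneg abs_square_le_1 power2_eq_1_iff abs_le_square_iff)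
  have "continuous_on UNIV \<gamma>"
    unfolding \<gamma>_def by (intro continuous_intros) auto
  moreover have "continuous_on unit_disc (sph_deriv f P)"
    using isCont_sph_deriv by (auto intro: continuous_at_imp_continuous_on)
  ultimately have "continuous_on UNIV (\<lambda>t. hs_norm f P (\<gamma> t))"
    unfolding hs using \<gamma>
    by (intro continuous_intros continuous_on_compose2[of unit_disc "sph_deriv f P" UNIV \<gamma>]) auto
  then have int: "(\<lambda>t. hs_norm f P (\<gamma> t)) integrable_on {0..r}" for r
    by (intro integrable_continuous_real) (auto intro: continuous_on_subset)
  obtain S where S: "\<And>t. disc_area t \<le> S" "\<exists>T. disc_area T > S - \<epsilon>"
  proof
    show "disc_area t \<le> (SUP t. disc_area t)" for t
      using bdd_above_disc_area by (intro cSUP_upper) auto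
    show "\<exists>T. disc_area T > (SUP t. disc_area t) - \<epsilon>"
      using less_cSUP_iff[of UNIV disc_area "(SUP t. disc_area t) - \<epsilon>"] bdd_above_disc_area \<epsilon> by auto
  qed
  then obtain T where T: "disc_area T > S - \<epsilon>"
    by blast
  \<comment> \<open>Beyond hyperbolic radius T less than \<epsilon> of area is left, so the disc
    around \<open>\<gamma> t\<close> is admissible in \<open>epsilon_regularity\<close>.\<close>
  have "\<forall>\<^sub>F t in at_top. t \<ge> 0 \<and> t - 2 \<ge> T"
    using eventually_ge_at_top[of "max 0 (T + 2)"] by (auto elim: eventually_mono)
  then have "\<forall>\<^sub>F t in at_top. (hs_norm f P (\<gamma> t))\<^sup>2 \<le> 4 * K * (disc_area (t + 2) - disc_area (t - 2))"
  proof eventually_elim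
    case (elim t)
    define x where "x = tanh (t / 2)"
    \<comment> \<open>Half the distance to the unit circle: the closed disc stays in
      \<open>unit_disc\<close>, and (1 - x^2)/2 <= 1 - x = 2 \<rho> bounds the hyperbolic factor.
      Squaring turns K into 4K.\<close>
    define \<rho> where "\<rho> = (1 - x) / 2"
    have x: "0 \<le> x" "x < 1"
      using elim by (auto simp: x_def tanh_real_lt_1)
    have \<gamma>x: "\<gamma> t = complex_of_real x * u" "norm (\<gamma> t) = x"
      using x(1) by (auto simp: norm_\<gamma>) (auto simp: \<gamma>_def x_def)
    have \<rho>: "\<rho> > 0"
      using x by (simp add: \<rho>_def)
    have sub: "cball (\<gamma> t) \<rho> \<subseteq> unit_disc"
    proof
      fix z assume "z \<in> cball (\<gamma> t) \<rho>"
      then have "norm z \<le> norm (\<gamma> t) + \<rho>"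
        using norm_triangle_ineq2[of z "\<gamma> t"] by (simp add: dist_norm norm_minus_commute)
      also have "\<dots> < 1"
        using x unfolding \<gamma>x(2) \<rho>_def by (simp add: field_simps)
      finally show "z \<in> unit_disc"
        by simp
    qed
    have le: "area (ball (\<gamma> t) \<rho>) \<le> disc_area (t + 2) - disc_area (t - 2)"
      using area_ball_le[of t u] elim u by (simp add: \<gamma>x \<rho>_def x_def)
    also have "\<dots> < \<epsilon>"
      using S(1)[of "t + 2"] T monoD[OF mono_disc_area, of T "t - 2"] elim by linarith
    finally have reg': "(\<rho> * sph_deriv f P (\<gamma> t))\<^sup>2 \<le> K * area (ball (\<gamma> t) \<rho>)"
      using reg[OF \<rho> sub] by blast
    have "(1 - x\<^sup>2) / 2 \<le> 2 * \<rho>"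
    proof -
      have "0 \<le> (1 - x)\<^sup>2"
        by simp
      then show ?thesis
        by (simp add: \<rho>_def power2_diff)
    qed
    then have "sph_deriv f P (\<gamma> t) * ((1 - x\<^sup>2) / 2) \<le> sph_deriv f P (\<gamma> t) * (2 * \<rho>)"
      by (intro mult_left_mono sph_deriv_nonneg)
    then have "hs_norm f P (\<gamma> t) \<le> 2 * (\<rho> * sph_deriv f P (\<gamma> t))"
      by (simp add: hs \<gamma>x(2) mult_ac)
    then have "(hs_norm f P (\<gamma> t))\<^sup>2 \<le> (2 * (\<rho> * sph_deriv f P (\<gamma> t)))\<^sup>2"
      using hs0 by (intro power_mono)
    also have "\<dots> = 4 * (\<rho> * sph_deriv f P (\<gamma> t))\<^sup>2"
      by (simp add: power_mult_distrib)
    also have "\<dots> \<le> 4 * (K * (disc_area (t + 2) - disc_area (t - 2)))"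
      using reg' mult_left_mono[OF le, of K] K by linarith
    finally show ?case
      by simp
  qed
  then have "(\<lambda>r. integral {0..r} (\<lambda>t. hs_norm f P (\<gamma> t))) \<in> o[at_top](sqrt)"
    using K by (intro integral_smallo_sqrt[OF mono_disc_area bdd_above_disc_area, of "4 * K"] int hs0) simp_all
  then show ?thesis
    by (simp add: \<gamma>_def)
qed

end

theorem theorem3p3:
  fixes f :: "complex \<Rightarrow> complex" and P :: "complex set" and \<theta> :: real
  assumes "meromorphic_disc f P"
    and "sph_area f < \<infinity>"
  shows "(\<lambda>r. radial_sph_length f P \<theta> r) \<in> o[at_top](\<lambda>r. sqrt r)"
proof -
  interpret finite_area_map f P
    using assms by unfold_locales
  show ?thesis
    unfolding radial_sph_length_def by (rule hs_norm_ray_smallo) simp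
qed

end
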